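(* Let $\mathcal{H}$ be a real Hilbert space, let $L>0$, $\mu\in[0,L[$ and $\rho\ge 0$ be such that $\mu+\rho>0$. Let $f\colon\mathcal{H}\to\mathbb{R}$ be a differentiable $\mu$-strongly convex function such that $\nabla f$ is $L$-Lipschitz continuous, and let $h\colon\mathcal{H}\to\left]-\infty,+\infty\right]$ be proper, lower semicontinuous and $\rho$-strongly convex. Let $x^*$ be the unique minimizer of $f+h$ over $\mathcal{H}$. For $\delta\in[-\mu,\rho]$, set $f_\delta=f+\frac{\delta}{2}\|\cdot\|^2$, $h_{-\delta}=h-\frac{\delta}{2}\|\cdot\|^2$, and, for every $\gamma>0$, $$T_\delta(\gamma)\colon\mathcal{H}\to\mathcal{H}\colon x\mapsto \mathrm{prox}_{\gamma h_{-\delta}}(x-\gamma\nabla f_\delta(x)).$$ Let $\delta\in[-\mu,\rho]$, set $\gamma_\delta=2/(L+\mu+2\delta)$, let $x_0\in\mathcal{H}$, and let $(x_k)_{k\in\mathbb{N}}$ be generated by $x_{k+1}=T_\delta(\gamma_\delta)x_k$ for every $k\in\mathbb{N}$. Then $T_\delta(\gamma_\delta)=T_0(2/(L+\mu))$ and $$(\forall k\in\mathbb{N})\quad \|x_k-x^*\|\le\left(\frac{L-\mu}{L+\mu+2\rho}\right)^{k}\|x_0-x^*\|.$$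
   Context: Conventions: for $\sigma\ge 0$, a function $\varphi\colon\mathcal{H}\to\left]-\infty,+\infty\right]$ is $\sigma$-strongly convex if $\varphi-\frac{\sigma}{2}\|\cdot\|^2$ is convex (so $0$-strongly convex means convex). For a proper lower semicontinuous convex function $\varphi$, the proximity operator is $\mathrm{prox}_{\varphi}(x)=\arg\min_{y\in\mathcal{H}}\varphi(y)+\frac12\|y-x\|^2$. $T_0(\gamma)$ denotes $T_\delta(\gamma)$ for $\delta=0$, i.e. $T_0(\gamma)x=\mathrm{prox}_{\gamma h}(x-\gamma\nabla f(x))$. $\mathbb{N}$ contains $0$. *)

theory Defs
  imports "HOL-Analysis.Analysis"
begin

text \<open>
  A real Hilbert space is a type of sort \<open>{real_inner, complete_space}\<close>. Functions into
  \<open>]-\<infinity>, +\<infinity>]\<close> are \<open>ereal\<close>-valued functions; that they avoid \<open>-\<infinity>\<close> is part of \<open>proper_fun\<close>.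
\<close>

definition proper_fun :: "('a \<Rightarrow> ereal) \<Rightarrow> bool" where
  "proper_fun \<phi> \<longleftrightarrow> (\<forall>x. \<phi> x \<noteq> -\<infinity>) \<and> (\<exists>x. \<phi> x \<noteq> \<infinity>)"

definition lsc_fun :: "('a::topological_space \<Rightarrow> ereal) \<Rightarrow> bool" where
  "lsc_fun \<phi> \<longleftrightarrow> (\<forall>x. \<phi> x \<le> Liminf (nhds x) \<phi>)"

text \<open>
  The weights may be \<open>0\<close>: since \<open>0 * \<infinity> = 0\<close> in \<open>ereal\<close>, the inequality is then trivial. The
  right-hand side is never \<open>\<infinity> + (-\<infinity>)\<close>, because \<open>\<phi>\<close> is only meant to take values above \<open>-\<infinity>\<close>.
\<close>

definition convex_fun :: "('a::real_vector \<Rightarrow> ereal) \<Rightarrow> bool" where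
  "convex_fun \<phi> \<longleftrightarrow>
     (\<forall>x y. \<forall>u\<ge>0. \<forall>v\<ge>0. u + v = 1 \<longrightarrow>
        \<phi> (u *\<^sub>R x + v *\<^sub>R y) \<le> ereal u * \<phi> x + ereal v * \<phi> y)"

definition strongly_convex_fun :: "real \<Rightarrow> ('a::real_normed_vector \<Rightarrow> ereal) \<Rightarrow> bool" where
  "strongly_convex_fun \<sigma> \<phi> \<longleftrightarrow> convex_fun (\<lambda>x. \<phi> x - ereal (\<sigma> / 2 * (norm x)\<^sup>2))"

lemma strongly_convex_fun_real_iff:
  "strongly_convex_fun \<sigma> (\<lambda>x. ereal (f x)) \<longleftrightarrow> convex_on UNIV (\<lambda>x. f x - \<sigma> / 2 * (norm x)\<^sup>2)"
  by (simp add: strongly_convex_fun_def convex_fun_def convex_on_def)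

text \<open>
  For a Frechet differentiable function on a Hilbert space the gradient exists (Riesz) and is
  unique, so the description below is proper.
\<close>

definition gradient :: "('a::real_inner \<Rightarrow> real) \<Rightarrow> 'a \<Rightarrow> 'a" where
  "gradient f x = (THE D. GDERIV f x :> D)"

definition prox :: "('a::real_normed_vector \<Rightarrow> ereal) \<Rightarrow> 'a \<Rightarrow> 'a" where
  "prox \<phi> x = (ARG_MIN (\<lambda>y. \<phi> y + ereal (1 / 2 * (norm (y - x))\<^sup>2)) y. True)"

text \<open>\<open>fb_operator f h \<delta> \<gamma>\<close> is the forward-backward operator \<open>T\<^sub>\<delta>(\<gamma>)\<close> for the splitting
  \<open>f + h = (f + \<delta>/2 \<parallel>\<cdot>\<parallel>\<^sup>2) + (h - \<delta>/2 \<parallel>\<cdot>\<parallel>\<^sup>2)\<close>.\<close>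

definition fb_operator ::
  "('a::real_inner \<Rightarrow> real) \<Rightarrow> ('a \<Rightarrow> ereal) \<Rightarrow> real \<Rightarrow> real \<Rightarrow> 'a \<Rightarrow> 'a" where
  "fb_operator f h \<delta> \<gamma> x =
     prox (\<lambda>y. ereal \<gamma> * (h y - ereal (\<delta> / 2 * (norm y)\<^sup>2)))
       (x - \<gamma> *\<^sub>R gradient (\<lambda>y. f y + \<delta> / 2 * (norm y)\<^sup>2) x)"

end

theory Submission
  imports Defs
begin

text \<open>
  Put \<open>\<kappa> = (L + \<mu>) / 2\<close> and let \<open>G\<close> be the gradient of \<open>f\<close>. The step size \<open>2 / (L + \<mu> + 2 \<delta>)\<close> is
  \<open>1 / (\<kappa> + \<delta>)\<close>, and with it the quadratic \<open>\<delta>/2 \<parallel>\<cdot>\<parallel>\<^sup>2\<close> that was moved from \<open>h\<close> to \<open>f\<close> cancels: the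
  function of \<open>y\<close> whose minimizer is \<open>T\<^sub>\<delta> x\<close> is, up to a positive factor and an additive constant,
  \<open>h y + y \<bullet> G x + \<kappa>/2 \<parallel>y - x\<parallel>\<^sup>2\<close>. This model (\<open>fb_model\<close>) does not contain \<open>\<delta>\<close>, so all the operators
  coincide (\<open>fb_operator_eq_arg_min_fb_model\<close>).

  For the rate, the model at \<open>x\<close> is \<open>(\<rho> + \<kappa>)\<close>-strongly convex, so it grows quadratically around its
  minimizer. Comparing the models at two points \<open>x\<close>, \<open>x'\<close> with minimizers \<open>p\<close>, \<open>q\<close> gives
  \<open>(\<rho> + \<kappa>) \<parallel>p - q\<parallel> \<le> \<parallel>\<kappa> (x - x') - (G x - G x')\<parallel>\<close> (\<open>fb_model_minimizer_contraction\<close>). The right-hand side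
  is at most \<open>(L - \<mu>)/2 \<parallel>x - x'\<parallel>\<close> (\<open>gradient_step_contraction\<close>): the function \<open>f - \<mu>/2 \<parallel>\<cdot>\<parallel>\<^sup>2\<close> is convex and
  smooth with constant \<open>L - \<mu>\<close>, so its gradient is cocoercive (Baillon and Haddad), and \<open>\<kappa> - \<mu>\<close> is
  exactly half of that constant. The quotient of the two constants is the stated rate. Finally the minimizer
  of \<open>f + h\<close> minimizes its own model (\<open>minimizer_minimizes_fb_model\<close>), so it may be taken as \<open>x'\<close> and
  \<open>q\<close>, and the bound is iterated.

  Existence of all minimizers involved, and the Riesz representation that turns Frechet derivatives into
  gradients, come from one fact: a proper lower semicontinuous strongly convex function on a Hilbert space
  has a minimizer (\<open>strongly_convex_minimizer_exists\<close>).
\<close>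

section \<open>Convexity, strong convexity and lower semicontinuity\<close>

lemma le_of_le_add_small:
  fixes a b c :: real
  assumes "\<And>t. 0 < t \<Longrightarrow> t < 1 \<Longrightarrow> a \<le> b + t * c"
  shows "a \<le> b"
proof (rule tendsto_lowerbound)
  show "((\<lambda>t. b + t * c) \<longlongrightarrow> b) (at_right 0)"
    by (auto intro!: tendsto_eq_intros)
  show "\<forall>\<^sub>F t in at_right 0. a \<le> b + t * c"
    using eventually_at_right_real[OF zero_less_one] by eventually_elim (use assms in auto)
qed simp

text \<open>
  Restricting the weights to be positive and the values to be finite reduces convexity to real
  arithmetic: zero weights are trivial, and with positive weights an infinite value makes the bound infinite.
\<close>

lemma convex_fun_iff_finite:
  fixes \<phi> :: "'a::real_vector \<Rightarrow> ereal"
  assumes "\<And>x. \<phi> x \<noteq> -\<infinity>"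
  shows "convex_fun \<phi> \<longleftrightarrow>
    (\<forall>x y a b u v. 0 < u \<longrightarrow> 0 < v \<longrightarrow> u + v = 1 \<longrightarrow> \<phi> x = ereal a \<longrightarrow> \<phi> y = ereal b \<longrightarrow>
       \<phi> (u *\<^sub>R x + v *\<^sub>R y) \<le> ereal (u * a + v * b))" (is "_ \<longleftrightarrow> ?R")
proof
  assume c: "convex_fun \<phi>"
  show ?R
  proof (intro allI impI)
    fix x y a b and u v :: real
    assume "0 < u" "0 < v" "u + v = 1" and e: "\<phi> x = ereal a" "\<phi> y = ereal b"
    then have "\<phi> (u *\<^sub>R x + v *\<^sub>R y) \<le> ereal u * \<phi> x + ereal v * \<phi> y"
      using c unfolding convex_fun_def by (blast intro: less_imp_le)
    then show "\<phi> (u *\<^sub>R x + v *\<^sub>R y) \<le> ereal (u * a + v * b)"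
      using e by simp
  qed
next
  assume R: ?R
  show "convex_fun \<phi>"
    unfolding convex_fun_def
  proof (intro allI impI)
    fix x y and u v :: real
    assume uv: "0 \<le> u" "0 \<le> v" "u + v = 1"
    consider "u = 0" "v = 1" | "u = 1" "v = 0" | "0 < u" "0 < v" using uv by fastforce
    then show "\<phi> (u *\<^sub>R x + v *\<^sub>R y) \<le> ereal u * \<phi> x + ereal v * \<phi> y"
    proof cases
      case 3
      then show ?thesis using R uv assms[of x] assms[of y]
        by (cases "\<phi> x"; cases "\<phi> y") auto
    qed (auto simp: zero_ereal_def[symmetric] one_ereal_def[symmetric])
  qed
qed

lemma convex_fun_add:
  assumes "\<And>x. \<phi> x \<noteq> -\<infinity>" "\<And>x. \<psi> x \<noteq> -\<infinity>" "convex_fun \<phi>" "convex_fun \<psi>"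
  shows "convex_fun (\<lambda>x. \<phi> x + \<psi> x)"
proof -
  have ne: "\<phi> x + \<psi> x \<noteq> -\<infinity>" for x using assms(1,2)[of x] by (cases "\<phi> x"; cases "\<psi> x") auto
  show ?thesis
    unfolding convex_fun_iff_finite[of "\<lambda>x. \<phi> x + \<psi> x", OF ne]
  proof (intro allI impI)
    fix x y a b and u v :: real
    assume uv: "0 < u" "0 < v" "u + v = 1"
      and e: "\<phi> x + \<psi> x = ereal a" "\<phi> y + \<psi> y = ereal b"
    obtain p q r s where pq: "\<phi> x = ereal p" "\<psi> x = ereal q" "\<phi> y = ereal r" "\<psi> y = ereal s"
      using e by (cases "\<phi> x"; cases "\<psi> x"; cases "\<phi> y"; cases "\<psi> y") auto
    have "\<phi> (u *\<^sub>R x + v *\<^sub>R y) \<le> ereal (u * p + v * r)"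
      using assms(3) pq uv unfolding convex_fun_iff_finite[of \<phi>, OF assms(1)] by blast
    moreover have "\<psi> (u *\<^sub>R x + v *\<^sub>R y) \<le> ereal (u * q + v * s)"
      using assms(4) pq uv unfolding convex_fun_iff_finite[of \<psi>, OF assms(2)] by blast
    ultimately have "\<phi> (u *\<^sub>R x + v *\<^sub>R y) + \<psi> (u *\<^sub>R x + v *\<^sub>R y)
        \<le> ereal (u * p + v * r) + ereal (u * q + v * s)"
      by (rule add_mono)
    also have "\<dots> = ereal (u * a + v * b)"
    proof -
      have "a = p + q" "b = r + s" using e pq by auto
      then show ?thesis by (simp add: algebra_simps)
    qed
    finally show "\<phi> (u *\<^sub>R x + v *\<^sub>R y) + \<psi> (u *\<^sub>R x + v *\<^sub>R y) \<le> ereal (u * a + v * b)" .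
  qed
qed

lemma strongly_convex_fun_add:
  assumes "\<And>x. \<phi> x \<noteq> -\<infinity>" "\<And>x. \<psi> x \<noteq> -\<infinity>"
    and "strongly_convex_fun \<sigma> \<phi>" "strongly_convex_fun \<tau> \<psi>"
  shows "strongly_convex_fun (\<sigma> + \<tau>) (\<lambda>x. \<phi> x + \<psi> x)"
proof -
  have "convex_fun (\<lambda>x. (\<phi> x - ereal (\<sigma> / 2 * (norm x)\<^sup>2)) + (\<psi> x - ereal (\<tau> / 2 * (norm x)\<^sup>2)))"
  proof (rule convex_fun_add)
    fix x
    show "\<phi> x - ereal (\<sigma> / 2 * (norm x)\<^sup>2) \<noteq> -\<infinity>" using assms(1)[of x] by (cases "\<phi> x") auto
    show "\<psi> x - ereal (\<tau> / 2 * (norm x)\<^sup>2) \<noteq> -\<infinity>" using assms(2)[of x] by (cases "\<psi> x") auto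
  qed (use assms(3,4) in \<open>simp_all add: strongly_convex_fun_def\<close>)
  also have "(\<lambda>x. (\<phi> x - ereal (\<sigma> / 2 * (norm x)\<^sup>2)) + (\<psi> x - ereal (\<tau> / 2 * (norm x)\<^sup>2)))
      = (\<lambda>x. (\<phi> x + \<psi> x) - ereal ((\<sigma> + \<tau>) / 2 * (norm x)\<^sup>2))"
  proof
    fix x
    show "(\<phi> x - ereal (\<sigma> / 2 * (norm x)\<^sup>2)) + (\<psi> x - ereal (\<tau> / 2 * (norm x)\<^sup>2))
      = (\<phi> x + \<psi> x) - ereal ((\<sigma> + \<tau>) / 2 * (norm x)\<^sup>2)"
      using assms(1,2)[of x] by (cases "\<phi> x"; cases "\<psi> x") (auto simp: field_simps)
  qed
  finally show ?thesis by (simp add: strongly_convex_fun_def)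
qed

lemma power2_norm_diff:
  fixes x y :: "'a::real_inner"
  shows "(norm (x - y))\<^sup>2 = (norm x)\<^sup>2 - 2 * (x \<bullet> y) + (norm y)\<^sup>2"
  unfolding power2_norm_eq_inner by (simp add: inner_simps inner_commute[of y x])

lemma norm_convex_combination:
  fixes x y :: "'a::real_inner"
  assumes "u + v = (1::real)"
  shows "(norm (u *\<^sub>R x + v *\<^sub>R y))\<^sup>2 = u * (norm x)\<^sup>2 + v * (norm y)\<^sup>2 - u * v * (norm (x - y))\<^sup>2"
proof -
  have "v = 1 - u" using assms by simp
  then show ?thesis
    unfolding power2_norm_eq_inner
    by (simp add: inner_simps inner_commute[of y x]) (simp add: algebra_simps)
qed

lemma strongly_convex_funD:
  fixes \<phi> :: "'a::real_inner \<Rightarrow> ereal"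
  assumes "strongly_convex_fun \<sigma> \<phi>" "0 \<le> u" "0 \<le> v" "u + v = 1"
    and e: "\<phi> x = ereal a" "\<phi> y = ereal b"
  shows "\<phi> (u *\<^sub>R x + v *\<^sub>R y) \<le> ereal (u * a + v * b - \<sigma> / 2 * u * v * (norm (x - y))\<^sup>2)"
proof -
  let ?z = "u *\<^sub>R x + v *\<^sub>R y"
  have "\<phi> ?z - ereal (\<sigma> / 2 * (norm ?z)\<^sup>2) \<le>
      ereal u * (\<phi> x - ereal (\<sigma> / 2 * (norm x)\<^sup>2)) + ereal v * (\<phi> y - ereal (\<sigma> / 2 * (norm y)\<^sup>2))"
    using assms(1-4) unfolding strongly_convex_fun_def convex_fun_def by blast
  also have "\<dots> = ereal (u * a + v * b - \<sigma> / 2 * (u * (norm x)\<^sup>2 + v * (norm y)\<^sup>2))"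
    using e by (simp add: algebra_simps)
  finally have "\<phi> ?z \<le> ereal (u * a + v * b - \<sigma> / 2 * (u * (norm x)\<^sup>2 + v * (norm y)\<^sup>2)
      + \<sigma> / 2 * (norm ?z)\<^sup>2)"
    by (cases "\<phi> ?z") auto
  then show ?thesis
    unfolding norm_convex_combination[OF assms(4)] by (simp add: algebra_simps)
qed

lemma convex_fun_if_strongly_convex:
  fixes \<phi> :: "'a::real_inner \<Rightarrow> ereal"
  assumes "\<And>x. \<phi> x \<noteq> -\<infinity>" "strongly_convex_fun \<sigma> \<phi>" "0 \<le> \<sigma>"
  shows "convex_fun \<phi>"
  unfolding convex_fun_iff_finite[of \<phi>, OF assms(1)]
proof (intro allI impI)
  fix x y a b and u v :: real
  assume uv: "0 < u" "0 < v" "u + v = 1" and "\<phi> x = ereal a" "\<phi> y = ereal b"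
  then have "\<phi> (u *\<^sub>R x + v *\<^sub>R y) \<le> ereal (u * a + v * b - \<sigma> / 2 * u * v * (norm (x - y))\<^sup>2)"
    by (intro strongly_convex_funD[OF assms(2)]) auto
  also have "\<dots> \<le> ereal (u * a + v * b)" using uv assms(3) by simp
  finally show "\<phi> (u *\<^sub>R x + v *\<^sub>R y) \<le> ereal (u * a + v * b)" .
qed

text \<open>Subtracting \<open>\<sigma>/2 \<parallel>\<cdot>\<parallel>\<^sup>2\<close> from such a quadratic leaves an affine function.\<close>

lemma strongly_convex_fun_quadratic:
  fixes l :: "'a::real_inner \<Rightarrow> real"
  assumes "linear l"
  shows "strongly_convex_fun \<sigma> (\<lambda>y. ereal (l y + \<sigma> / 2 * (norm (y - w))\<^sup>2))"
proof -
  interpret linear l by fact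
  have "l y + \<sigma> / 2 * (norm (y - w))\<^sup>2 - \<sigma> / 2 * (norm y)\<^sup>2
      = l y - \<sigma> * (y \<bullet> w) + \<sigma> / 2 * (norm w)\<^sup>2" for y
    by (simp add: power2_norm_diff field_simps)
  moreover have "convex_on UNIV (\<lambda>y. l y - \<sigma> * (y \<bullet> w) + \<sigma> / 2 * (norm w)\<^sup>2)"
  proof (rule convex_onI)
    fix t :: real and x y
    show "l ((1 - t) *\<^sub>R x + t *\<^sub>R y) - \<sigma> * (((1 - t) *\<^sub>R x + t *\<^sub>R y) \<bullet> w) + \<sigma> / 2 * (norm w)\<^sup>2
      \<le> (1 - t) * (l x - \<sigma> * (x \<bullet> w) + \<sigma> / 2 * (norm w)\<^sup>2)
        + t * (l y - \<sigma> * (y \<bullet> w) + \<sigma> / 2 * (norm w)\<^sup>2)"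
      by (simp add: add scale inner_simps) (simp add: field_simps)
  qed simp
  ultimately show ?thesis unfolding strongly_convex_fun_real_iff by (simp only:)
qed

text \<open>Testing with real levels only suffices, because the reals are dense in the extended reals.\<close>

lemma lsc_fun_iff_eventually:
  "lsc_fun \<phi> \<longleftrightarrow> (\<forall>x c. ereal c < \<phi> x \<longrightarrow> (\<forall>\<^sub>F y in nhds x. ereal c < \<phi> y))"
  unfolding lsc_fun_def le_Liminf_iff
proof (intro iffI allI impI)
  fix x and d :: ereal
  assume *: "\<forall>x c. ereal c < \<phi> x \<longrightarrow> (\<forall>\<^sub>F y in nhds x. ereal c < \<phi> y)" and "d < \<phi> x"
  then obtain c where "d < ereal c" "ereal c < \<phi> x" using ereal_dense2 by blast
  with * have "\<forall>\<^sub>F y in nhds x. ereal c < \<phi> y" by blast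
  then show "\<forall>\<^sub>F y in nhds x. d < \<phi> y"
    by eventually_elim (use \<open>d < ereal c\<close> in order)
qed blast

lemma lsc_fun_add_continuous:
  fixes \<phi> :: "'a::topological_space \<Rightarrow> ereal"
  assumes "lsc_fun \<phi>" "continuous_on UNIV g"
  shows "lsc_fun (\<lambda>x. \<phi> x + ereal (g x))"
  unfolding lsc_fun_iff_eventually
proof (intro allI impI)
  fix x and c :: real
  assume "ereal c < \<phi> x + ereal (g x)"
  then have "ereal (c - g x) < \<phi> x" by (cases "\<phi> x") auto
  then obtain e where e: "ereal (c - g x) < ereal e" "ereal e < \<phi> x" using ereal_dense2 by blast
  have "\<forall>\<^sub>F y in nhds x. ereal e < \<phi> y"
    using assms(1) e(2) unfolding lsc_fun_iff_eventually by blast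
  moreover have "\<forall>\<^sub>F y in nhds x. c - e < g y"
  proof -
    have "(g \<longlongrightarrow> g x) (nhds x)"
      using assms(2) by (simp add: continuous_on_def tendsto_at_iff_tendsto_nhds)
    moreover have "c - e < g x" using e(1) by simp
    ultimately show ?thesis by (rule order_tendstoD)
  qed
  ultimately show "\<forall>\<^sub>F y in nhds x. ereal c < \<phi> y + ereal (g y)"
  proof eventually_elim
    case (elim y)
    then show ?case by (cases "\<phi> y") auto
  qed
qed

section \<open>Minimizers of strongly convex functions\<close>

text \<open>
  Lower semicontinuity bounds \<open>\<phi>\<close> below on a small ball around a point \<open>z\<close> of finite value. For \<open>y\<close> outside
  the ball, strong convexity on the segment from \<open>z\<close> to \<open>y\<close>, applied where the segment leaves the ball,
  forces \<open>\<phi> y\<close> above a quadratic in \<open>\<parallel>y - z\<parallel>\<close> with leading coefficient \<open>\<sigma>/2\<close>, and a quadratic with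
  positive leading coefficient is bounded below.
\<close>

lemma strongly_convex_bounded_below:
  fixes \<phi> :: "'a::real_inner \<Rightarrow> ereal"
  assumes "proper_fun \<phi>" "lsc_fun \<phi>" "strongly_convex_fun \<sigma> \<phi>" "0 < \<sigma>"
  obtains m where "\<And>y. ereal m \<le> \<phi> y"
proof -
  have ninf: "\<phi> y \<noteq> -\<infinity>" for y using assms(1) by (simp add: proper_fun_def)
  obtain z a where a: "\<phi> z = ereal a"
    using assms(1) unfolding proper_fun_def by (metis ereal_cases)
  have "\<forall>\<^sub>F y in nhds z. ereal (a - 1) < \<phi> y"
    using assms(2) a unfolding lsc_fun_iff_eventually by simp
  then obtain e where "e > 0" and e: "\<And>y. dist y z < e \<Longrightarrow> ereal (a - 1) < \<phi> y"
    unfolding eventually_nhds_metric by blast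
  define r where "r = e / 2"
  have r: "0 < r" and loc: "\<And>y. norm (y - z) \<le> r \<Longrightarrow> ereal (a - 1) < \<phi> y"
    using e \<open>e > 0\<close> by (auto simp: r_def dist_norm)
  \<comment> \<open>Outside the ball the lower bound is \<open>a - k d + \<sigma>/2 d\<^sup>2\<close> with \<open>d = \<parallel>y - z\<parallel>\<close>; its minimum over \<open>d\<close>
     is \<open>a - k\<^sup>2 / (2 \<sigma>)\<close>. The further \<open>-1\<close> covers the points inside the ball.\<close>
  define k where "k = 1 / r + \<sigma> / 2 * r"
  have "ereal (a - 1 - k\<^sup>2 / (2 * \<sigma>)) \<le> \<phi> y" for y
  proof (cases "norm (y - z) \<le> r")
    case True
    have "a - 1 - k\<^sup>2 / (2 * \<sigma>) \<le> a - 1" using assms(4) by simp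
    then show ?thesis using loc[OF True] by (metis ereal_less_eq(3) less_imp_le order_trans)
  next
    case False
    define d where "d = norm (y - z)"
    \<comment> \<open>The weight of \<open>y\<close> in the point where the segment from \<open>z\<close> to \<open>y\<close> meets the sphere of radius \<open>r\<close>.\<close>
    define t where "t = r / d"
    have d: "r < d" using False by (simp add: d_def)
    then have t: "0 < t" "t < 1" and td: "t * d = r" using r by (auto simp: t_def)
    show ?thesis
    proof (cases "\<phi> y")
      case (real b)
      have "norm (((1 - t) *\<^sub>R z + t *\<^sub>R y) - z) = norm (t *\<^sub>R (y - z))"
        by (simp add: algebra_simps)
      also have "\<dots> = r" using t td by (simp add: d_def)
      finally have "ereal (a - 1) < \<phi> ((1 - t) *\<^sub>R z + t *\<^sub>R y)" using loc by simp
      also have "\<dots> \<le> ereal ((1 - t) * a + t * b - \<sigma> / 2 * (1 - t) * t * (norm (z - y))\<^sup>2)"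
        using t by (intro strongly_convex_funD[OF assms(3)]) (use a real in auto)
      finally have "t * a < 1 + t * b - \<sigma> / 2 * (1 - t) * t * d\<^sup>2"
        by (simp add: d_def norm_minus_commute algebra_simps)
      then have "d * (t * a) < d * (1 + t * b - \<sigma> / 2 * (1 - t) * t * d\<^sup>2)"
        using d r by simp
      also have "d * (t * a) = r * a" unfolding td[symmetric] by simp
      also have "d * (1 + t * b - \<sigma> / 2 * (1 - t) * t * d\<^sup>2) = r * b + d * (1 + \<sigma> / 2 * r\<^sup>2) - \<sigma> / 2 * r * d\<^sup>2"
        unfolding td[symmetric] by (simp add: field_simps power2_eq_square)
      also have "1 + \<sigma> / 2 * r\<^sup>2 = r * k" using r by (simp add: k_def field_simps power2_eq_square)
      finally have "r * a < r * (b + d * k - \<sigma> / 2 * d\<^sup>2)" by (simp add: algebra_simps)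
      then have "a < b + d * k - \<sigma> / 2 * d\<^sup>2" using r by simp
      moreover have "d * k - \<sigma> / 2 * d\<^sup>2 = k\<^sup>2 / (2 * \<sigma>) - (\<sigma> * d - k)\<^sup>2 / (2 * \<sigma>)"
        using assms(4) by (simp add: field_simps power2_eq_square)
      moreover have "0 \<le> (\<sigma> * d - k)\<^sup>2 / (2 * \<sigma>)" using assms(4) by simp
      ultimately have "a - 1 - k\<^sup>2 / (2 * \<sigma>) \<le> b" by linarith
      then show ?thesis using real by simp
    qed (use ninf in auto)
  qed
  then show ?thesis using that by blast
qed

text \<open>
  A minimizing sequence is Cauchy: the value at the midpoint of two of its terms is at least the infimum,
  while strong convexity puts it below the average of the two values by \<open>\<sigma>/8\<close> times their squared
  distance. Lower semicontinuity makes the limit a minimizer.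
\<close>

lemma strongly_convex_minimizer_exists:
  fixes \<phi> :: "'a::{real_inner, complete_space} \<Rightarrow> ereal"
  assumes "proper_fun \<phi>" "lsc_fun \<phi>" "strongly_convex_fun \<sigma> \<phi>" "0 < \<sigma>"
  obtains z where "is_arg_min \<phi> (\<lambda>_. True) z"
proof -
  obtain m0 where m0: "\<And>y. ereal m0 \<le> \<phi> y"
    using strongly_convex_bounded_below[OF assms] by blast
  obtain x a where a: "\<phi> x = ereal a"
    using assms(1) unfolding proper_fun_def by (metis ereal_cases)
  have "ereal m0 \<le> (INF y. \<phi> y)" "(INF y. \<phi> y) \<le> ereal a"
    using m0 a by (auto intro!: INF_greatest INF_lower2[of x])
  then obtain m where m: "(INF y. \<phi> y) = ereal m" by (cases "INF y. \<phi> y") auto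
  have lower: "ereal m \<le> \<phi> y" for y unfolding m[symmetric] by (rule INF_lower) simp
  have "\<exists>y b. \<phi> y = ereal b \<and> b < m + 1 / real (Suc n)" for n
  proof -
    have "(INF y. \<phi> y) < ereal (m + 1 / real (Suc n))" unfolding m by simp
    then obtain y where "\<phi> y < ereal (m + 1 / real (Suc n))" by (auto simp: INF_less_iff)
    with lower[of y] show ?thesis by (cases "\<phi> y") auto
  qed
  then obtain y b where yb: "\<And>n. \<phi> (y n) = ereal (b n)" "\<And>n. b n < m + 1 / real (Suc n)"
    by metis
  have close: "\<sigma> / 4 * (norm (y i - y j))\<^sup>2 \<le> 1 / real (Suc i) + 1 / real (Suc j)" for i j
  proof -
    have "ereal m \<le> \<phi> ((1/2) *\<^sub>R y i + (1/2) *\<^sub>R y j)" by (rule lower)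
    also have "\<dots> \<le> ereal (1/2 * b i + 1/2 * b j - \<sigma> / 2 * (1/2) * (1/2) * (norm (y i - y j))\<^sup>2)"
      by (intro strongly_convex_funD[OF assms(3)]) (use yb in auto)
    finally have "m \<le> 1/2 * b i + 1/2 * b j - \<sigma> / 2 * (1/2) * (1/2) * (norm (y i - y j))\<^sup>2" by simp
    then have "\<sigma> / 4 * (norm (y i - y j))\<^sup>2 \<le> b i + b j - 2 * m" by (simp add: field_simps)
    then show ?thesis using yb(2)[of i] yb(2)[of j] by linarith
  qed
  have "Cauchy y"
  proof (rule metric_CauchyI)
    fix e :: real
    assume "0 < e"
    then have "0 < \<sigma> / 8 * e\<^sup>2" using assms(4) by simp
    then obtain N where N: "1 / real (Suc N) < \<sigma> / 8 * e\<^sup>2" using nat_approx_posE by blast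
    have "dist (y i) (y j) < e" if "N \<le> i" "N \<le> j" for i j
    proof -
      have "1 / real (Suc i) \<le> 1 / real (Suc N)" "1 / real (Suc j) \<le> 1 / real (Suc N)"
        using that by (auto simp: frac_le)
      then have "\<sigma> / 4 * (norm (y i - y j))\<^sup>2 < \<sigma> / 4 * e\<^sup>2" using close[of i j] N by linarith
      then have "(norm (y i - y j))\<^sup>2 < e\<^sup>2" using assms(4) by simp
      then show ?thesis using \<open>0 < e\<close> unfolding dist_norm by (simp add: power2_less_imp_less)
    qed
    then show "\<exists>M. \<forall>i\<ge>M. \<forall>j\<ge>M. dist (y i) (y j) < e" by blast
  qed
  then obtain z where z: "y \<longlonglongrightarrow> z" using Cauchy_convergent convergent_def by blast
  have "\<phi> z \<le> ereal m"
  proof (rule ccontr)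
    assume "\<not> \<phi> z \<le> ereal m"
    then have "ereal m < \<phi> z" by simp
    then obtain c where c: "ereal m < ereal c" "ereal c < \<phi> z" using ereal_dense2 by blast
    then have "\<forall>\<^sub>F w in nhds z. ereal c < \<phi> w"
      using assms(2) unfolding lsc_fun_iff_eventually by blast
    from eventually_compose_filterlim[OF this z]
    have "\<forall>\<^sub>F n in sequentially. c < b n" by (simp add: yb(1))
    moreover have "\<forall>\<^sub>F n in sequentially. 1 / real (Suc n) < c - m"
      using LIMSEQ_Suc[OF lim_1_over_n] c(1) by (intro order_tendstoD(2)[of _ 0]) auto
    ultimately have "\<forall>\<^sub>F n in sequentially. False"
    proof eventually_elim
      case (elim n)
      then show ?case using yb(2)[of n] by simp
    qed
    then show False by simp
  qed
  then have "is_arg_min \<phi> (\<lambda>_. True) z"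
    using lower unfolding is_arg_min_linorder by (blast intro: order_trans)
  then show ?thesis using that by blast
qed

lemma is_arg_min_ereal_finite:
  assumes "proper_fun \<phi>" "is_arg_min \<phi> (\<lambda>_. True) z"
  obtains a where "\<phi> z = ereal a"
  using assms unfolding proper_fun_def is_arg_min_linorder
  by (metis ereal_cases ereal_infty_less_eq(1))

text \<open>
  Along the segment from \<open>z\<close> to \<open>y\<close>, minimality of \<open>z\<close> and strong convexity give the bound with an extra
  factor \<open>1 - t\<close> in front of the quadratic term; let \<open>t\<close> tend to \<open>0\<close>.
\<close>

lemma strongly_convex_minimizer_growth:
  fixes \<phi> :: "'a::real_inner \<Rightarrow> ereal"
  assumes "proper_fun \<phi>" "strongly_convex_fun \<sigma> \<phi>" "is_arg_min \<phi> (\<lambda>_. True) z"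
  shows "\<phi> z + ereal (\<sigma> / 2 * (norm (y - z))\<^sup>2) \<le> \<phi> y"
proof -
  obtain a where a: "\<phi> z = ereal a" using is_arg_min_ereal_finite[OF assms(1,3)] .
  have min: "\<phi> z \<le> \<phi> w" for w using assms(3) by (simp add: is_arg_min_linorder)
  show ?thesis
  proof (cases "\<phi> y")
    case (real b)
    have "a + \<sigma> / 2 * (norm (y - z))\<^sup>2 \<le> b"
    proof (rule le_of_le_add_small)
      fix t :: real
      assume t: "0 < t" "t < 1"
      have "ereal a \<le> \<phi> ((1 - t) *\<^sub>R z + t *\<^sub>R y)" using min a by metis
      also have "\<dots> \<le> ereal ((1 - t) * a + t * b - \<sigma> / 2 * (1 - t) * t * (norm (z - y))\<^sup>2)"
        using t by (intro strongly_convex_funD[OF assms(2)]) (use a real in auto)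
      finally have "t * (a + \<sigma> / 2 * (norm (y - z))\<^sup>2)
          \<le> t * (b + t * (\<sigma> / 2 * (norm (y - z))\<^sup>2))"
        by (simp add: norm_minus_commute field_simps)
      then show "a + \<sigma> / 2 * (norm (y - z))\<^sup>2 \<le> b + t * (\<sigma> / 2 * (norm (y - z))\<^sup>2)"
        using t by simp
    qed
    then show ?thesis using a real by simp
  qed (use assms(1) in \<open>auto simp: proper_fun_def\<close>)
qed

lemma strongly_convex_minimizer_ex1:
  fixes \<phi> :: "'a::{real_inner, complete_space} \<Rightarrow> ereal"
  assumes "proper_fun \<phi>" "lsc_fun \<phi>" "strongly_convex_fun \<sigma> \<phi>" "0 < \<sigma>"
  shows "\<exists>!z. is_arg_min \<phi> (\<lambda>_. True) z"
proof (rule ex_ex1I)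
  show "\<exists>z. is_arg_min \<phi> (\<lambda>_. True) z"
    using strongly_convex_minimizer_exists[OF assms] by blast
  fix z w
  assume zw: "is_arg_min \<phi> (\<lambda>_. True) z" "is_arg_min \<phi> (\<lambda>_. True) w"
  obtain a where a: "\<phi> z = ereal a" using is_arg_min_ereal_finite[OF assms(1) zw(1)] .
  have "\<phi> w \<le> \<phi> z" using zw(2) by (simp add: is_arg_min_linorder)
  with strongly_convex_minimizer_growth[OF assms(1,3) zw(1), of w]
  have "\<phi> z + ereal (\<sigma> / 2 * (norm (w - z))\<^sup>2) \<le> \<phi> z" by order
  then have "\<sigma> / 2 * (norm (w - z))\<^sup>2 \<le> 0" using a by simp
  then show "z = w" using assms(4) by (simp add: mult_le_0_iff)
qed

section \<open>Gradients of smooth convex functions\<close>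

text \<open>
  The representing vector is the minimizer of \<open>\<parallel>y\<parallel>\<^sup>2/2 - l y\<close>: the first-order condition at the minimizer
  is \<open>l d = d \<bullet> z\<close> for every direction \<open>d\<close>.
\<close>

lemma riesz_representation:
  fixes l :: "'a::{real_inner, complete_space} \<Rightarrow> real"
  assumes "bounded_linear l"
  obtains z where "\<And>d. l d = d \<bullet> z"
proof -
  interpret bounded_linear l by fact
  \<comment> \<open>The trivial shift by \<open>0\<close> gives \<open>q\<close> the form in \<open>strongly_convex_fun_quadratic\<close>.\<close>
  define q where "q y = - l y + 1 / 2 * (norm (y - 0))\<^sup>2" for y
  have "continuous_on UNIV q"
    unfolding q_def using linear_continuous_on[OF assms] by (intro continuous_intros)
  then have "lsc_fun (\<lambda>y. 0 + ereal (q y))"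
    by (intro lsc_fun_add_continuous) (auto simp: lsc_fun_iff_eventually)
  moreover have "strongly_convex_fun 1 (\<lambda>y. ereal (q y))"
    unfolding q_def
    by (intro strongly_convex_fun_quadratic) (simp add: linear_compose_neg linear_axioms)
  ultimately obtain z where "is_arg_min (\<lambda>y. ereal (q y)) (\<lambda>_. True) z"
    using strongly_convex_minimizer_exists[of "\<lambda>y. ereal (q y)" 1] by (auto simp: proper_fun_def)
  then have min: "q z \<le> q y" for y by (simp add: is_arg_min_linorder)
  have le: "l d \<le> d \<bullet> z" for d
  proof (rule le_of_le_add_small)
    fix t :: real
    assume t: "0 < t" "t < 1"
    have "q (z + t *\<^sub>R d) = q z + t * (d \<bullet> z + t * (1 / 2 * (norm d)\<^sup>2) - l d)"
      unfolding q_def power2_norm_eq_inner add scale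
      by (simp add: inner_simps inner_commute[of z d] algebra_simps)
    then have "0 \<le> t * (d \<bullet> z + t * (1 / 2 * (norm d)\<^sup>2) - l d)" using min[of "z + t *\<^sub>R d"] by simp
    then show "l d \<le> d \<bullet> z + t * (1 / 2 * (norm d)\<^sup>2)" using t by (simp add: zero_le_mult_iff)
  qed
  have "l d = d \<bullet> z" for d using le[of d] le[of "- d"] by (simp add: neg)
  then show ?thesis using that by blast
qed

lemma gradient_eqI:
  assumes "GDERIV f x :> D"
  shows "gradient f x = D"
  unfolding gradient_def
proof (rule the_equality)
  show "GDERIV f x :> D" by (fact assms)
  fix E
  assume "GDERIV f x :> E"
  then have "(\<lambda>h. h \<bullet> E) = (\<lambda>h. h \<bullet> D)"
    using assms unfolding gderiv_def by (rule has_derivative_unique)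
  then show "E = D" by (metis inner_commute vector_eq_ldot)
qed

lemma GDERIV_gradient:
  fixes f :: "'a::{real_inner, complete_space} \<Rightarrow> real"
  assumes "f differentiable (at x)"
  shows "GDERIV f x :> gradient f x"
proof -
  obtain l where l: "(f has_derivative l) (at x)" using assms unfolding differentiable_def by blast
  obtain D where "\<And>d. l d = d \<bullet> D"
    using riesz_representation[OF has_derivative_bounded_linear[OF l]] by blast
  then have "l = (\<lambda>d. d \<bullet> D)" by (rule ext)
  then have "GDERIV f x :> D" using l by (simp add: gderiv_def)
  then show ?thesis using gradient_eqI by metis
qed

lemma GDERIV_add_quadratic:
  fixes x :: "'a::real_inner"
  assumes "GDERIV f x :> D"
  shows "GDERIV (\<lambda>y. f y + c / 2 * (norm y)\<^sup>2) x :> D + c *\<^sub>R x"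
proof -
  have "GDERIV (\<lambda>y. c / 2 * (y \<bullet> y)) x :> c *\<^sub>R x"
    unfolding gderiv_def by (auto intro!: derivative_eq_intros simp: inner_commute algebra_simps)
  then show ?thesis using assms GDERIV_add unfolding power2_norm_eq_inner by blast
qed

lemma GDERIV_along_line:
  fixes x d :: "'a::real_inner"
  assumes "GDERIV f (x + t *\<^sub>R d) :> D"
  shows "((\<lambda>s. f (x + s *\<^sub>R d)) has_field_derivative d \<bullet> D) (at t)"
proof -
  have "((\<lambda>s. x + s *\<^sub>R d) has_derivative (\<lambda>s. s *\<^sub>R d)) (at t)"
    by (auto intro!: derivative_eq_intros)
  from diff_chain_at[OF this, of f "\<lambda>d. d \<bullet> D"] assms
  have "((\<lambda>s. f (x + s *\<^sub>R d)) has_derivative (\<lambda>s. (s *\<^sub>R d) \<bullet> D)) (at t)"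
    by (simp add: gderiv_def o_def)
  also have "(\<lambda>s. (s *\<^sub>R d) \<bullet> D) = (*) (d \<bullet> D)" by auto
  finally show ?thesis by (simp add: has_field_derivative_def)
qed

lemma convex_above_gradient:
  fixes f :: "'a::real_inner \<Rightarrow> real"
  assumes "convex_on UNIV f" "GDERIV f x :> D"
  shows "f x + (y - x) \<bullet> D \<le> f y"
proof -
  have "convex_on UNIV (\<lambda>t. f (x + t *\<^sub>R (y - x)))"
  proof (rule convex_onI)
    fix t a b :: real
    assume "0 < t" "t < 1"
    moreover have "x + ((1 - t) *\<^sub>R a + t *\<^sub>R b) *\<^sub>R (y - x)
        = (1 - t) *\<^sub>R (x + a *\<^sub>R (y - x)) + t *\<^sub>R (x + b *\<^sub>R (y - x))"
      by (simp add: algebra_simps)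
    ultimately show "f (x + ((1 - t) *\<^sub>R a + t *\<^sub>R b) *\<^sub>R (y - x))
        \<le> (1 - t) * f (x + a *\<^sub>R (y - x)) + t * f (x + b *\<^sub>R (y - x))"
      using convex_onD[OF assms(1)] by simp
  qed simp
  moreover have "((\<lambda>s. f (x + s *\<^sub>R (y - x))) has_field_derivative (y - x) \<bullet> D) (at 0)"
    using assms(2) by (intro GDERIV_along_line) simp
  ultimately have "(y - x) \<bullet> D * (1 - 0) \<le> f (x + 1 *\<^sub>R (y - x)) - f (x + 0 *\<^sub>R (y - x))"
    by (intro convex_on_imp_above_tangent[where A = UNIV]) auto
  then show ?thesis by simp
qed

text \<open>
  On the segment from \<open>x\<close> to \<open>y\<close>, the difference of the two sides has derivative of constant sign, by
  Cauchy--Schwarz and the Lipschitz bound.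
\<close>

lemma descent_lemma:
  fixes f :: "'a::real_inner \<Rightarrow> real"
  assumes "\<And>x. GDERIV f x :> G x" "L-lipschitz_on UNIV G"
  shows "f y \<le> f x + (y - x) \<bullet> G x + L / 2 * (norm (y - x))\<^sup>2"
proof -
  define d where "d = y - x"
  define F where "F t = f (x + t *\<^sub>R d) - t * (d \<bullet> G x) - L / 2 * t\<^sup>2 * (norm d)\<^sup>2" for t
  have "F 1 \<le> F 0"
  proof (rule DERIV_nonpos_imp_nonincreasing[where f = F])
    fix t :: real
    assume t: "0 \<le> t" "t \<le> 1"
    let ?D = "d \<bullet> G (x + t *\<^sub>R d) - d \<bullet> G x - L * t * (norm d)\<^sup>2"
    have "(F has_field_derivative ?D) (at t)"
      unfolding F_def
      by (auto intro!: derivative_eq_intros GDERIV_along_line assms(1))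
    moreover have "?D \<le> 0"
    proof -
      have "d \<bullet> (G (x + t *\<^sub>R d) - G x) \<le> norm d * norm (G (x + t *\<^sub>R d) - G x)"
        by (rule norm_cauchy_schwarz)
      also have "\<dots> \<le> norm d * (L * (t * norm d))"
        using lipschitz_onD[OF assms(2), of "x + t *\<^sub>R d" x] t
        by (intro mult_left_mono) (auto simp: dist_norm)
      finally show ?thesis by (simp add: inner_simps power2_eq_square algebra_simps)
    qed
    ultimately show "\<exists>D. (F has_field_derivative D) (at t) \<and> D \<le> 0" by blast
  qed simp
  then show ?thesis by (simp add: F_def d_def)
qed

text \<open>
  The Baillon--Haddad inequality. The lower bound at \<open>x\<close> and the upper bound at \<open>y\<close> are compared at the
  point \<open>z\<close> obtained from \<open>y\<close> by a gradient step of length \<open>1/M\<close> for \<open>g - (\<cdot>) \<bullet> G x\<close>, a function that \<open>x\<close>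
  minimizes. This improves the lower bound by \<open>\<parallel>G x - G y\<parallel>\<^sup>2 / (2 M)\<close>; adding the improved bounds for
  \<open>(x, y)\<close> and \<open>(y, x)\<close> cancels the function values.
\<close>

lemma smooth_convex_cocoercive:
  fixes g :: "'a::real_inner \<Rightarrow> real"
  assumes lower: "\<And>x y. g x + (y - x) \<bullet> G x \<le> g y"
    and upper: "\<And>x y. g y \<le> g x + (y - x) \<bullet> G x + M / 2 * (norm (y - x))\<^sup>2"
    and "0 < M"
  shows "(norm (G x - G y))\<^sup>2 \<le> M * ((x - y) \<bullet> (G x - G y))"
proof -
  have half: "g x + (y - x) \<bullet> G x + (norm (G x - G y))\<^sup>2 / (2 * M) \<le> g y" for x y
  proof -
    define e where "e = G y - G x"
    define z where "z = y - (1 / M) *\<^sub>R e"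
    have "g x + (z - x) \<bullet> G x \<le> g y + (z - y) \<bullet> G y + M / 2 * (norm (z - y))\<^sup>2"
      using lower[of x z] upper[of z y] by linarith
    moreover have "(z - x) \<bullet> G x = (y - x) \<bullet> G x - (e \<bullet> G x) / M"
      by (simp add: z_def inner_simps)
    moreover have "(z - y) \<bullet> G y = - (e \<bullet> G y) / M" by (simp add: z_def)
    moreover have "(norm (z - y))\<^sup>2 = (norm e)\<^sup>2 / M\<^sup>2"
      using \<open>0 < M\<close> by (simp add: z_def power_divide)
    moreover have "M / 2 * ((norm e)\<^sup>2 / M\<^sup>2) = (norm e)\<^sup>2 / (2 * M)"
      by (simp add: power2_eq_square)
    moreover have "(e \<bullet> G y) / M - (e \<bullet> G x) / M = 2 * ((norm e)\<^sup>2 / (2 * M))"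
    proof -
      have "e \<bullet> G y - e \<bullet> G x = (norm e)\<^sup>2"
        by (simp add: e_def power2_norm_eq_inner inner_diff_right)
      then show ?thesis by (simp flip: diff_divide_distrib)
    qed
    moreover have "norm (G x - G y) = norm e" by (simp add: e_def norm_minus_commute)
    ultimately show ?thesis by simp
  qed
  have "(norm (G x - G y))\<^sup>2 / (2 * M) + (norm (G x - G y))\<^sup>2 / (2 * M) \<le> (x - y) \<bullet> (G x - G y)"
    using half[of x y] half[of y x] by (simp add: norm_minus_commute inner_simps)
  then show ?thesis using \<open>0 < M\<close> by (simp add: field_simps)
qed

text \<open>
  Let \<open>d = x - y\<close> and let \<open>e\<close> be the difference of the gradients of \<open>g = f - \<mu>/2 \<parallel>\<cdot>\<parallel>\<^sup>2\<close> at these points.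
  The vector on the left is \<open>c d - e\<close> with \<open>c = (L + \<mu>)/2 - \<mu> = (L - \<mu>)/2\<close>. With this \<open>c\<close>, cocoercivity of
  the gradient of \<open>g\<close>, with constant \<open>L - \<mu> = 2 c\<close>, says that the terms of \<open>\<parallel>c d - e\<parallel>\<^sup>2\<close> containing \<open>e\<close> have a
  sum \<open>\<le> 0\<close>.
\<close>

lemma gradient_step_contraction:
  fixes f :: "'a::real_inner \<Rightarrow> real"
  assumes grad: "\<And>x. GDERIV f x :> G x" and lip: "L-lipschitz_on UNIV G"
    and conv: "convex_on UNIV (\<lambda>x. f x - \<mu> / 2 * (norm x)\<^sup>2)" and "\<mu> < L"
  shows "norm (((L + \<mu>) / 2) *\<^sub>R (x - y) - (G x - G y)) \<le> (L - \<mu>) / 2 * norm (x - y)"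
proof -
  define g where "g x = f x - \<mu> / 2 * (norm x)\<^sup>2" for x
  define E where "E x = G x - \<mu> *\<^sub>R x" for x
  have gE: "GDERIV g x :> E x" for x
    using GDERIV_add_quadratic[OF grad[of x], of "- \<mu>"] by (simp add: g_def[abs_def] E_def)
  have lower: "g x + (y - x) \<bullet> E x \<le> g y" for x y
    using convex_above_gradient[OF _ gE] conv by (simp add: g_def[abs_def])
  have upper: "g y \<le> g x + (y - x) \<bullet> E x + (L - \<mu>) / 2 * (norm (y - x))\<^sup>2" for x y
  proof -
    have "\<mu> / 2 * (norm y)\<^sup>2 = \<mu> / 2 * (norm x)\<^sup>2 + (y - x) \<bullet> (\<mu> *\<^sub>R x) + \<mu> / 2 * (norm (y - x))\<^sup>2"
      unfolding power2_norm_eq_inner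
      by (simp add: inner_simps inner_commute[of y x]) (simp add: algebra_simps)
    then show ?thesis
      using descent_lemma[OF grad lip, of y x]
      by (simp add: g_def E_def inner_diff_right field_simps)
  qed
  define d e where "d = x - y" and "e = E x - E y"
  have co: "(norm e)\<^sup>2 \<le> (L - \<mu>) * (d \<bullet> e)"
    using smooth_convex_cocoercive[OF lower upper] \<open>\<mu> < L\<close> by (simp add: d_def e_def)
  have "((L + \<mu>) / 2) *\<^sub>R (x - y) - (G x - G y) = ((L - \<mu>) / 2) *\<^sub>R d - e"
    by (simp add: d_def e_def E_def algebra_simps flip: scaleR_add_left)
       (simp add: field_simps flip: scaleR_add_left scaleR_diff_left)
  moreover have "(norm (c *\<^sub>R d - e))\<^sup>2 = (c * norm d)\<^sup>2 + ((norm e)\<^sup>2 - 2 * c * (d \<bullet> e))" for c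
    unfolding power2_norm_eq_inner power_mult_distrib
    by (simp add: inner_simps inner_commute[of e d] power2_eq_square algebra_simps)
  ultimately have "(norm (((L + \<mu>) / 2) *\<^sub>R (x - y) - (G x - G y)))\<^sup>2
      = ((L - \<mu>) / 2 * norm d)\<^sup>2 + ((norm e)\<^sup>2 - 2 * ((L - \<mu>) / 2) * (d \<bullet> e))"
    by (simp only:)
  moreover have "2 * ((L - \<mu>) / 2) = L - \<mu>" by simp
  ultimately have "(norm (((L + \<mu>) / 2) *\<^sub>R (x - y) - (G x - G y)))\<^sup>2 \<le> ((L - \<mu>) / 2 * norm d)\<^sup>2"
    using co by (simp only:)
  then show ?thesis unfolding d_def by (rule power2_le_imp_le) (use \<open>\<mu> < L\<close> in simp)
qed

section \<open>The model minimized by a forward-backward step\<close>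

text \<open>
  With \<open>v\<close> the gradient of \<open>f\<close> at \<open>w\<close>, this is, up to an additive constant, \<open>f + h\<close> with \<open>f\<close> linearized at
  \<open>w\<close>, plus a proximal term. The linear part is \<open>y \<bullet> v\<close> rather than \<open>(y - w) \<bullet> v\<close>, which does not affect the
  minimizers.
\<close>

definition fb_model :: "('a::real_inner \<Rightarrow> ereal) \<Rightarrow> real \<Rightarrow> 'a \<Rightarrow> 'a \<Rightarrow> 'a \<Rightarrow> ereal" where
  "fb_model h \<kappa> w v y = h y + ereal (y \<bullet> v + \<kappa> / 2 * (norm (y - w))\<^sup>2)"

lemma arg_min_ereal_affine:
  fixes \<phi> :: "'a \<Rightarrow> ereal"
  assumes "0 < k"
  shows "arg_min (\<lambda>y. ereal k * \<phi> y + ereal c) P = arg_min \<phi> P"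
proof -
  have "ereal k * a + ereal c < ereal k * b + ereal c \<longleftrightarrow> a < b" for a b
    using assms by (cases a; cases b) auto
  then show ?thesis unfolding arg_min_def is_arg_min_def by simp
qed

text \<open>
  With \<open>\<gamma> = 1 / (\<kappa> + \<delta>)\<close> we have \<open>1 - \<gamma> \<delta> = \<gamma> \<kappa>\<close>. Hence the terms of the proximal objective in
  \<open>\<parallel>y\<parallel>\<^sup>2\<close> and in \<open>y \<bullet> x\<close>, which carry the factor \<open>1 - \<gamma> \<delta>\<close>, are \<open>\<gamma>\<close> times those of the model.
\<close>

lemma fb_operator_eq_arg_min_fb_model:
  fixes f :: "'a::real_inner \<Rightarrow> real"
  assumes "GDERIV f x :> D" "0 < \<kappa> + \<delta>" "\<And>y. h y \<noteq> -\<infinity>"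
  shows "fb_operator f h \<delta> (1 / (\<kappa> + \<delta>)) x = arg_min (fb_model h \<kappa> x D) (\<lambda>_. True)"
proof -
  define \<gamma> where "\<gamma> = 1 / (\<kappa> + \<delta>)"
  have "0 < \<gamma>" and \<gamma>\<kappa>: "\<gamma> * \<kappa> = 1 - \<gamma> * \<delta>" using assms(2) by (auto simp: \<gamma>_def field_simps)
  define u where "u = x - \<gamma> *\<^sub>R (D + \<delta> *\<^sub>R x)"
  define c where "c = 1 / 2 * (norm u)\<^sup>2 - \<gamma> * \<kappa> / 2 * (norm x)\<^sup>2"
  have real_eq: "\<gamma> * (r - \<delta> / 2 * (norm y)\<^sup>2) + 1 / 2 * (norm (y - u))\<^sup>2
      = \<gamma> * (r + (y \<bullet> D + \<kappa> / 2 * (norm (y - x))\<^sup>2)) + c" for r y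
  proof -
    have yu: "y \<bullet> u = (1 - \<gamma> * \<delta>) * (y \<bullet> x) - \<gamma> * (y \<bullet> D)"
      by (simp add: u_def inner_simps algebra_simps)
    have distrib: "\<gamma> * (r + (y \<bullet> D + \<kappa> / 2 * s)) = \<gamma> * r + \<gamma> * (y \<bullet> D) + \<gamma> * \<kappa> / 2 * s" for s
      by (simp add: distrib_left)
    show ?thesis
      unfolding distrib c_def \<gamma>\<kappa> power2_norm_diff yu by (simp add: field_simps)
  qed
  have "ereal \<gamma> * (h y - ereal (\<delta> / 2 * (norm y)\<^sup>2)) + ereal (1 / 2 * (norm (y - u))\<^sup>2)
      = ereal \<gamma> * fb_model h \<kappa> x D y + ereal c" for y
    using real_eq[of _ y] assms(3)[of y] \<open>0 < \<gamma>\<close> unfolding fb_model_def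
    by (cases "h y") simp_all
  then show ?thesis
    using gradient_eqI[OF GDERIV_add_quadratic[OF assms(1)], of \<delta>] arg_min_ereal_affine[OF \<open>0 < \<gamma>\<close>]
    unfolding fb_operator_def prox_def by (simp add: \<gamma>_def[symmetric] u_def[symmetric])
qed

lemma fb_model_proper:
  assumes "proper_fun h"
  shows "proper_fun (fb_model h \<kappa> w v)"
  using assms unfolding proper_fun_def fb_model_def by auto

lemma fb_model_lsc:
  assumes "lsc_fun h"
  shows "lsc_fun (fb_model h \<kappa> w v)"
  unfolding fb_model_def by (intro lsc_fun_add_continuous assms continuous_intros)

lemma fb_model_strongly_convex:
  assumes "proper_fun h" "strongly_convex_fun \<rho> h"
  shows "strongly_convex_fun (\<rho> + \<kappa>) (fb_model h \<kappa> w v)"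
  unfolding fb_model_def
  by (intro strongly_convex_fun_add assms strongly_convex_fun_quadratic)
     (use assms(1) in \<open>auto simp: proper_fun_def bounded_linear_inner_left bounded_linear.linear\<close>)

text \<open>
  Quadratic growth of the first model at \<open>p\<close>, tested at \<open>q\<close>, and of the second at \<open>q\<close>, tested at \<open>p\<close>: in
  the sum, the values of \<open>h\<close> and the squares of norms cancel, leaving an inner product with \<open>p - q\<close>.
\<close>

lemma fb_model_minimizer_contraction:
  assumes "proper_fun h" "strongly_convex_fun \<rho> h"
    and p: "is_arg_min (fb_model h \<kappa> x v) (\<lambda>_. True) p"
    and q: "is_arg_min (fb_model h \<kappa> x' v') (\<lambda>_. True) q"
  shows "(\<rho> + \<kappa>) * norm (p - q) \<le> norm (\<kappa> *\<^sub>R (x - x') - (v - v'))"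
proof -
  note growth = strongly_convex_minimizer_growth[OF fb_model_proper fb_model_strongly_convex]
  have gp: "fb_model h \<kappa> x v p + ereal ((\<rho> + \<kappa>) / 2 * (norm (p - q))\<^sup>2) \<le> fb_model h \<kappa> x v q"
    using growth[OF assms(1,1,2) p, of q] by (simp add: norm_minus_commute)
  have gq: "fb_model h \<kappa> x' v' q + ereal ((\<rho> + \<kappa>) / 2 * (norm (p - q))\<^sup>2) \<le> fb_model h \<kappa> x' v' p"
    using growth[OF assms(1,1,2) q, of p] by simp
  obtain a b where "fb_model h \<kappa> x v p = ereal a" "fb_model h \<kappa> x' v' q = ereal b"
    using is_arg_min_ereal_finite[OF fb_model_proper] assms(1) p q by metis
  then obtain hp hq where "h p = ereal hp" "h q = ereal hq"
    unfolding fb_model_def by (cases "h p"; cases "h q") auto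
  then have "(\<rho> + \<kappa>) * (norm (p - q))\<^sup>2
      \<le> (q - p) \<bullet> v - (q - p) \<bullet> v'
        + \<kappa> / 2 * ((norm (q - x))\<^sup>2 - (norm (p - x))\<^sup>2 + (norm (p - x'))\<^sup>2 - (norm (q - x'))\<^sup>2)"
    using gp gq unfolding fb_model_def by (simp add: inner_simps field_simps)
  also have "\<dots> = (p - q) \<bullet> (\<kappa> *\<^sub>R (x - x') - (v - v'))"
    unfolding power2_norm_diff by (simp add: inner_simps field_simps)
  also have "\<dots> \<le> norm (p - q) * norm (\<kappa> *\<^sub>R (x - x') - (v - v'))" by (rule norm_cauchy_schwarz)
  finally have "norm (p - q) * ((\<rho> + \<kappa>) * norm (p - q))
      \<le> norm (p - q) * norm (\<kappa> *\<^sub>R (x - x') - (v - v'))"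
    by (simp add: power2_eq_square mult.left_commute)
  then show ?thesis by (cases "p = q") auto
qed

text \<open>
  Fermat's rule for \<open>f + h\<close>: moving from \<open>z\<close> towards \<open>y\<close> by a fraction \<open>t\<close>, convexity bounds the change
  of \<open>h\<close> by \<open>t (h y - h z)\<close>, and the upper bound on \<open>f\<close> is linear up to order \<open>t\<^sup>2\<close>. Dividing by \<open>t\<close> and
  letting it tend to \<open>0\<close> gives \<open>h z \<le> h y + (y - z) \<bullet> v\<close>; the proximal term is nonnegative and \<open>0\<close> at \<open>z\<close>.
\<close>

lemma minimizer_minimizes_fb_model:
  fixes f :: "'a::real_inner \<Rightarrow> real"
  assumes "proper_fun h" "convex_fun h" "0 \<le> \<kappa>"
    and upper: "\<And>y. f y \<le> f z + (y - z) \<bullet> v + M / 2 * (norm (y - z))\<^sup>2"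
    and min: "is_arg_min (\<lambda>y. ereal (f y) + h y) (\<lambda>_. True) z"
  shows "is_arg_min (fb_model h \<kappa> z v) (\<lambda>_. True) z"
proof -
  have ninf: "h y \<noteq> -\<infinity>" for y using assms(1) by (simp add: proper_fun_def)
  have "proper_fun (\<lambda>y. ereal (f y) + h y)"
    using assms(1) unfolding proper_fun_def by auto
  then obtain s where "ereal (f z) + h z = ereal s" using is_arg_min_ereal_finite[OF _ min] by blast
  then obtain a where a: "h z = ereal a" by (cases "h z") auto
  have "fb_model h \<kappa> z v z \<le> fb_model h \<kappa> z v y" for y
  proof (cases "h y")
    case (real b)
    have "a \<le> b + (y - z) \<bullet> v"
    proof (rule le_of_le_add_small)
      fix t :: real
      assume t: "0 < t" "t < 1"
      let ?w = "(1 - t) *\<^sub>R z + t *\<^sub>R y"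
      have w: "?w - z = t *\<^sub>R (y - z)" by (simp add: algebra_simps)
      have "h ?w \<le> ereal (1 - t) * h z + ereal t * h y"
        using assms(2) t unfolding convex_fun_def by simp
      also have "\<dots> = ereal ((1 - t) * a + t * b)" using a real by simp
      finally have hw: "h ?w \<le> ereal ((1 - t) * a + t * b)" .
      have "ereal (f z) + h z \<le> ereal (f ?w) + h ?w" using min by (simp add: is_arg_min_linorder)
      also have "\<dots> \<le> ereal (f ?w) + ereal ((1 - t) * a + t * b)" using hw by (rule add_left_mono)
      finally have "f z + a \<le> f ?w + ((1 - t) * a + t * b)" using a by simp
      moreover have "f ?w \<le> f z + t * ((y - z) \<bullet> v) + M / 2 * (t * norm (y - z))\<^sup>2"
        using upper[of ?w] t unfolding w by simp
      ultimately have "t * a \<le> t * (b + (y - z) \<bullet> v + t * (M / 2 * (norm (y - z))\<^sup>2))"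
        by (simp add: algebra_simps power2_eq_square)
      then show "a \<le> b + (y - z) \<bullet> v + t * (M / 2 * (norm (y - z))\<^sup>2)" using t by simp
    qed
    then have "a + z \<bullet> v \<le> b + y \<bullet> v + \<kappa> / 2 * (norm (y - z))\<^sup>2"
      using assms(3) by (simp add: inner_simps add_increasing2)
    then show ?thesis using a real by (simp add: fb_model_def add.assoc)
  qed (use ninf in \<open>auto simp: fb_model_def\<close>)
  then show ?thesis by (simp add: is_arg_min_linorder)
qed

section \<open>Linear convergence\<close>

theorem corollary4p1:
  fixes f :: "'a::{real_inner, complete_space} \<Rightarrow> real"
    and h :: "'a \<Rightarrow> ereal"
    and L \<mu> \<rho> \<delta> :: real
    and xstar x0 :: 'a
    and x :: "nat \<Rightarrow> 'a"
  assumes "L > 0" and "0 \<le> \<mu>" and "\<mu> < L" and "\<rho> \<ge> 0" and "\<mu> + \<rho> > 0"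
    and "\<And>y. f differentiable (at y)"
    and "strongly_convex_fun \<mu> (\<lambda>y. ereal (f y))"
    and "L-lipschitz_on UNIV (gradient f)"
    and "proper_fun h" and "lsc_fun h" and "strongly_convex_fun \<rho> h"
    and "xstar = (ARG_MIN (\<lambda>y. ereal (f y) + h y) y. True)"
    and "- \<mu> \<le> \<delta>" and "\<delta> \<le> \<rho>"
    and "x 0 = x0"
    and "\<And>k. x (Suc k) = fb_operator f h \<delta> (2 / (L + \<mu> + 2 * \<delta>)) (x k)"
  shows "(\<exists>!z. is_arg_min (\<lambda>y. ereal (f y) + h y) (\<lambda>_. True) z) \<and>
         fb_operator f h \<delta> (2 / (L + \<mu> + 2 * \<delta>)) = fb_operator f h 0 (2 / (L + \<mu>)) \<and>
         (\<forall>k. norm (x k - xstar) \<le> ((L - \<mu>) / (L + \<mu> + 2 * \<rho>)) ^ k * norm (x0 - xstar))"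
proof (intro conjI allI)
  let ?F = "\<lambda>y. ereal (f y) + h y"
  define \<kappa> where "\<kappa> = (L + \<mu>) / 2"
  define model where "model w = fb_model h \<kappa> w (gradient f w)" for w
  have \<kappa>: "0 < \<kappa>" using assms(1,2) by (simp add: \<kappa>_def)
  have \<kappa>\<delta>: "0 < \<kappa> + \<delta>" using assms(3,13) unfolding \<kappa>_def by argo
  have grad: "GDERIV f y :> gradient f y" for y using GDERIV_gradient assms(6) by blast
  have ninf: "h y \<noteq> -\<infinity>" for y using assms(9) by (simp add: proper_fun_def)
  have F_proper: "proper_fun ?F"
    using assms(9) unfolding proper_fun_def by auto
  have "continuous_on UNIV f"
    using assms(6) by (simp add: continuous_on_eq_continuous_at differentiable_imp_continuous_within)
  then have F_lsc: "lsc_fun ?F"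
    using lsc_fun_add_continuous[OF assms(10)] by (simp add: add.commute)
  have F_conv: "strongly_convex_fun (\<mu> + \<rho>) ?F"
    using assms(7,11) ninf by (intro strongly_convex_fun_add) auto
  show ex1: "\<exists>!z. is_arg_min ?F (\<lambda>_. True) z"
    using strongly_convex_minimizer_ex1[OF F_proper F_lsc F_conv assms(5)] .
  then have xstar: "is_arg_min ?F (\<lambda>_. True) xstar"
    unfolding assms(12) arg_min_def by (rule ex1E) (rule someI)

  have step: "fb_operator f h \<eta> (2 / (L + \<mu> + 2 * \<eta>)) y = arg_min (model y) (\<lambda>_. True)"
    if "0 < \<kappa> + \<eta>" for \<eta> y
  proof -
    have "2 / (L + \<mu> + 2 * \<eta>) = 1 / (\<kappa> + \<eta>)" using that by (simp add: \<kappa>_def field_simps)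
    then show ?thesis
      using fb_operator_eq_arg_min_fb_model[where h = h, OF grad that ninf, of y] by (simp add: model_def)
  qed
  show "fb_operator f h \<delta> (2 / (L + \<mu> + 2 * \<delta>)) = fb_operator f h 0 (2 / (L + \<mu>))"
    using step[of \<delta>] step[of 0] \<kappa> \<kappa>\<delta> by (intro ext) simp

  have "convex_fun h" by (rule convex_fun_if_strongly_convex[OF ninf assms(11,4)])
  then have fixpoint: "is_arg_min (model xstar) (\<lambda>_. True) xstar"
    unfolding model_def using assms(9) \<kappa> xstar descent_lemma[OF grad assms(8)]
    by (intro minimizer_minimizes_fb_model[where f = f and M = L]) auto
  have "\<exists>p. is_arg_min (model w) (\<lambda>_. True) p" for w
    using strongly_convex_minimizer_exists[OF fb_model_proper fb_model_lsc fb_model_strongly_convex]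
      assms(4,9-11) \<kappa> unfolding model_def by (metis add_nonneg_pos)
  then have next_min: "is_arg_min (model (x k)) (\<lambda>_. True) (x (Suc k))" for k
    unfolding assms(16) step[OF \<kappa>\<delta>] arg_min_def by (rule someI_ex)

  let ?r = "(L - \<mu>) / (L + \<mu> + 2 * \<rho>)"
  have contraction: "norm (x (Suc k) - xstar) \<le> ?r * norm (x k - xstar)" for k
  proof -
    have "(\<rho> + \<kappa>) * norm (x (Suc k) - xstar)
        \<le> norm (\<kappa> *\<^sub>R (x k - xstar) - (gradient f (x k) - gradient f xstar))"
      using fb_model_minimizer_contraction[OF assms(9,11)] next_min fixpoint
      unfolding model_def by blast
    also have "\<dots> \<le> (L - \<mu>) / 2 * norm (x k - xstar)"
      using gradient_step_contraction[OF grad assms(8) _ assms(3)] assms(7)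
      unfolding \<kappa>_def strongly_convex_fun_real_iff by blast
    finally have "(L + \<mu> + 2 * \<rho>) * norm (x (Suc k) - xstar) \<le> (L - \<mu>) * norm (x k - xstar)"
      by (simp add: \<kappa>_def field_simps)
    moreover have "0 < L + \<mu> + 2 * \<rho>" using assms(1,2,4) by linarith
    ultimately show ?thesis by (simp add: field_simps)
  qed
  have "0 \<le> ?r" using assms(1-4) by simp
  show "norm (x k - xstar) \<le> ?r ^ k * norm (x0 - xstar)" for k
  proof (induction k)
    case (Suc k)
    have "norm (x (Suc k) - xstar) \<le> ?r * norm (x k - xstar)" by (rule contraction)
    also have "\<dots> \<le> ?r * (?r ^ k * norm (x0 - xstar))"
      using Suc \<open>0 \<le> ?r\<close> by (rule mult_left_mono)
    finally show ?case by (simp add: mult.assoc)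
  qed (simp add: assms(15))
qed

end
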